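(* Let $(S_1,\mathbf{g}_1)$ and $(S_2,\mathbf{g}_2)$ be two metric surfaces and let $\phi:S_1\to S_2$ be a quasi-conformal map with Beltrami differential $\mu\,\frac{d\overline{z}}{dz}$. Let $z$ and $w$ denote local isothermal coordinates of $S_1$ and $S_2$ respectively, so that locally $\mathbf{g}_1=e^{2\lambda_1(z)}\,dz\,d\overline{z}$ and $\mathbf{g}_2=e^{2\lambda_2(w)}\,dw\,d\overline{w}$. Define an auxiliary Riemannian metric on $S_1$ by $$\tilde{\mathbf{g}}_1=e^{2\lambda_1(z)}\,|dz+\mu\,d\overline{z}|^2 .$$ Then $\tilde{\mathbf{g}}_1$ is well-defined (that is, the local expressions in different isothermal charts of $S_1$ agree on overlaps), and the map $\phi:(S_1,\tilde{\mathbf{g}}_1)\to(S_2,\mathbf{g}_2)$ is a conformal map.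
   Context: A metric surface is an oriented surface with a Riemannian metric $\mathbf{g}$. It is covered by isothermal coordinate charts $z$, in which $\mathbf{g}=e^{2\lambda(z)}dz\,d\overline{z}$; these charts make it a Riemann surface (transition maps between isothermal charts are holomorphic). Notation: $\frac{\partial}{\partial z}=\frac12\left(\frac{\partial}{\partial x}-i\frac{\partial}{\partial y}\right)$, $\frac{\partial}{\partial\overline z}=\frac12\left(\frac{\partial}{\partial x}+i\frac{\partial}{\partial y}\right)$. A map $f$ between plane domains is quasi-conformal associated to $\mu$ if it is orientation-preserving and satisfies the Beltrami equation $\frac{\partial f}{\partial\overline z}=\mu(z)\frac{\partial f}{\partial z}$, where $\mu$ is a complex-valued Lebesgue measurable function with $\sup|\mu|<1$. A Beltrami differential $\mu(z)\frac{d\overline z}{dz}$ on a Riemann surface is an assignment to each chart $z_\alpha$ on $U_\alpha$ of an $L_\infty$ complex-valued function $\mu^\alpha$ on $z_\alpha(U_\alpha)$ such that $\mu^\alpha(z_\alpha)=\mu^\beta(z_\beta)\,\overline{\left(\frac{dz_\beta}{dz_\alpha}\right)}\Big/\left(\frac{dz_\beta}{dz_\alpha}\right)$ on the region also covered by another chart $z_\beta$. An orientation-preserving homeomorphism $f:S_1\to S_2$ of Riemann surfaces is quasi-conformal associated to $\mu\frac{d\overline z}{dz}$ if for any chart $z_\alpha$ on $S_1$ and any chart $w_\beta$ on $S_2$ the map $w_\beta\circ f\circ z_\alpha^{-1}$ is quasi-conformal associated to $\mu^\alpha$. Two metrics $\mathbf{g},\overline{\mathbf{g}}$ on a surface are conformal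 if $\overline{\mathbf{g}}=e^{2u}\mathbf{g}$ for a scalar function $u$. The map $\phi:(S_1,\tilde{\mathbf{g}}_1)\to(S_2,\mathbf{g}_2)$ is conformal if the pull-back metric $\phi^*\mathbf{g}_2$, given locally by $e^{2\lambda_2(\phi(z))}|d\phi(z)|^2$, is conformal to $\tilde{\mathbf{g}}_1$. Derivatives of $\phi$ and equalities of such metrics are understood in the usual sense for quasi-conformal maps (almost everywhere). *)

theory Defs
  imports "HOL-Analysis.Analysis"
begin

section \<open>Maps between plane domains\<close>

text \<open>Real differentiability of class \<open>C\<^sup>k\<close>; the plane is identified with \<^typ>\<open>complex\<close>, and
  \<open>fx\<close>, \<open>fy\<close> are the two partial derivatives of \<open>f\<close>.\<close>

primrec Ck_on :: "nat \<Rightarrow> complex set \<Rightarrow> (complex \<Rightarrow> 'b::real_normed_vector) \<Rightarrow> bool" where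
  "Ck_on 0 S f \<longleftrightarrow> continuous_on S f"
| "Ck_on (Suc k) S f \<longleftrightarrow>
     (\<exists>fx fy. (\<forall>z\<in>S. (f has_derivative (\<lambda>v. Re v *\<^sub>R fx z + Im v *\<^sub>R fy z)) (at z)) \<and>
              Ck_on k S fx \<and> Ck_on k S fy)"

definition smooth_on :: "complex set \<Rightarrow> (complex \<Rightarrow> 'b::real_normed_vector) \<Rightarrow> bool" where
  "smooth_on S f \<longleftrightarrow> (\<forall>k. Ck_on k S f)"

abbreviation D :: "(complex \<Rightarrow> complex) \<Rightarrow> complex \<Rightarrow> complex \<Rightarrow> complex" where
  "D f z \<equiv> frechet_derivative f (at z)"

text \<open>\<open>D f z 1\<close> and \<open>D f z \<i>\<close> are the partial derivatives of \<open>f\<close> in \<open>x\<close> and \<open>y\<close>.\<close>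

definition jacobian :: "(complex \<Rightarrow> complex) \<Rightarrow> complex \<Rightarrow> real" where
  "jacobian f z = Re (D f z 1) * Im (D f z \<i>) - Im (D f z 1) * Re (D f z \<i>)"

definition d_z :: "(complex \<Rightarrow> complex) \<Rightarrow> complex \<Rightarrow> complex" where
  "d_z f z = (D f z 1 - \<i> * D f z \<i>) / 2"

definition d_zbar :: "(complex \<Rightarrow> complex) \<Rightarrow> complex \<Rightarrow> complex" where
  "d_zbar f z = (D f z 1 + \<i> * D f z \<i>) / 2"

definition abs_continuous_on :: "real set \<Rightarrow> (real \<Rightarrow> complex) \<Rightarrow> bool" where
  "abs_continuous_on I f \<longleftrightarrow>
     (\<forall>\<epsilon>>0. \<exists>\<delta>>0. \<forall>P. P division_of \<Union>P \<and> \<Union>P \<subseteq> I \<and> (\<Sum>K\<in>P. Sup K - Inf K) < \<delta> \<longrightarrow>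
        (\<Sum>K\<in>P. norm (f (Sup K) - f (Inf K))) < \<epsilon>)"

text \<open>Absolute continuity on lines: on every closed rectangle in \<open>\<Omega>\<close>, \<open>f\<close> is absolutely continuous
  along almost every horizontal and almost every vertical segment.\<close>

definition ACL_on :: "complex set \<Rightarrow> (complex \<Rightarrow> complex) \<Rightarrow> bool" where
  "ACL_on \<Omega> f \<longleftrightarrow>
     (\<forall>a b c d. cbox (Complex a c) (Complex b d) \<subseteq> \<Omega> \<longrightarrow>
        (AE y in lebesgue_on {c..d}. abs_continuous_on {a..b} (\<lambda>x. f (Complex x y))) \<and>
        (AE x in lebesgue_on {a..b}. abs_continuous_on {c..d} (\<lambda>y. f (Complex x y))))"

text \<open>As usual for quasi-conformal maps, derivatives are taken almost everywhere: an ACL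
  homeomorphism is (totally) differentiable at almost every point, by Gehring and Lehto. Orientation
  preservation is the positivity of the Jacobian of this derivative, again almost everywhere.
  The condition \<open>sup |\<mu>| < 1\<close> is on the essential supremum.\<close>

definition orientation_preserving_on :: "complex set \<Rightarrow> (complex \<Rightarrow> complex) \<Rightarrow> bool" where
  "orientation_preserving_on \<Omega> f \<longleftrightarrow>
     (AE z in lebesgue_on \<Omega>. f differentiable (at z) \<and> jacobian f z > 0)"

definition quasiconformal_on ::
    "complex set \<Rightarrow> (complex \<Rightarrow> complex) \<Rightarrow> (complex \<Rightarrow> complex) \<Rightarrow> bool" where
  "quasiconformal_on \<Omega> f \<mu> \<longleftrightarrow>
     open \<Omega> \<and> homeomorphism \<Omega> (f ` \<Omega>) f (inv_into \<Omega> f) \<and> ACL_on \<Omega> f \<and>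
     orientation_preserving_on \<Omega> f \<and>
     \<mu> \<in> borel_measurable (lebesgue_on \<Omega>) \<and>
     (\<exists>k<1. AE z in lebesgue_on \<Omega>. cmod (\<mu> z) \<le> k) \<and>
     (AE z in lebesgue_on \<Omega>. d_zbar f z = \<mu> z * d_z f z)"


section \<open>Charts and metric surfaces\<close>

text \<open>A chart is its domain together with its coordinate function, whose values outside the domain
  are irrelevant.\<close>

type_synonym 'a chart = "'a set \<times> ('a \<Rightarrow> complex)"

definition chart_on :: "'a topology \<Rightarrow> 'a chart \<Rightarrow> bool" where
  "chart_on X c \<longleftrightarrow> openin X (fst c) \<and> open (snd c ` fst c) \<and>
     homeomorphic_map (subtopology X (fst c)) (top_of_set (snd c ` fst c)) (snd c)"

abbreviation chart_image :: "'a chart \<Rightarrow> complex set" where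
  "chart_image c \<equiv> snd c ` fst c"

definition chart_inv :: "'a chart \<Rightarrow> complex \<Rightarrow> 'a" where
  "chart_inv c = inv_into (fst c) (snd c)"

text \<open>The coordinate expression of \<open>\<phi>\<close> and the set on which it is meaningful.\<close>

definition local_rep :: "'a chart \<Rightarrow> 'b chart \<Rightarrow> ('a \<Rightarrow> 'b) \<Rightarrow> complex \<Rightarrow> complex" where
  "local_rep c d \<phi> = snd d \<circ> \<phi> \<circ> chart_inv c"

definition local_dom :: "'a chart \<Rightarrow> 'b chart \<Rightarrow> ('a \<Rightarrow> 'b) \<Rightarrow> complex set" where
  "local_dom c d \<phi> = snd c ` (fst c \<inter> \<phi> -` fst d)"

abbreviation transition :: "'a chart \<Rightarrow> 'a chart \<Rightarrow> complex \<Rightarrow> complex" where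
  "transition c d \<equiv> local_rep c d id"

abbreviation overlap :: "'a chart \<Rightarrow> 'a chart \<Rightarrow> complex set" where
  "overlap c d \<equiv> local_dom c d id"

definition oriented_compatible :: "'a chart \<Rightarrow> 'a chart \<Rightarrow> bool" where
  "oriented_compatible c d \<longleftrightarrow>
     smooth_on (overlap c d) (transition c d) \<and>
     (\<forall>z\<in>overlap c d. jacobian (transition c d) z > 0)"

text \<open>The smooth structure and orientation are given by a maximal oriented atlas.\<close>

locale oriented_surface =
  fixes X :: "'a topology" and A :: "'a chart set"
  assumes hausdorff: "Hausdorff_space X"
    and second_countable: "second_countable X"
    and charts: "c \<in> A \<Longrightarrow> chart_on X c"
    and cover: "(\<Union>c\<in>A. fst c) = topspace X"
    and compatible: "c \<in> A \<Longrightarrow> d \<in> A \<Longrightarrow> oriented_compatible c d"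
    and maximal: "chart_on X c \<Longrightarrow> (\<And>d. d \<in> A \<Longrightarrow> oriented_compatible c d \<and> oriented_compatible d c)
      \<Longrightarrow> c \<in> A"

text \<open>The expression of a metric in a coordinate assigns to each point of the plane a bilinear form
  on tangent vectors. A metric on a surface consists of one such expression for each chart.\<close>

type_synonym local_metric = "complex \<Rightarrow> complex \<Rightarrow> complex \<Rightarrow> real"

definition inner_form :: "(complex \<Rightarrow> complex \<Rightarrow> real) \<Rightarrow> bool" where
  "inner_form B \<longleftrightarrow> bilinear B \<and> (\<forall>v w. B v w = B w v) \<and> (\<forall>v. v \<noteq> 0 \<longrightarrow> B v v > 0)"

definition pullback :: "(complex \<Rightarrow> complex) \<Rightarrow> local_metric \<Rightarrow> local_metric" where
  "pullback F h z v w = h (F z) (D F z v) (D F z w)"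

text \<open>For a complex-valued real-linear form \<open>\<alpha>\<close>, \<open>|\<alpha>|\<^sup>2\<close> stands for the bilinear form
  \<open>\<alpha> v \<bullet> \<alpha> w\<close>; so \<open>|dz|\<^sup>2\<close>, the product of \<open>dz\<close> and its conjugate, is \<open>v \<bullet> w\<close>.\<close>

definition isothermal_with :: "('a chart \<Rightarrow> local_metric) \<Rightarrow> 'a chart \<Rightarrow> (complex \<Rightarrow> real) \<Rightarrow> bool" where
  "isothermal_with g c l \<longleftrightarrow> (\<forall>z\<in>chart_image c. \<forall>v w. g c z v w = exp (2 * l z) * (v \<bullet> w))"

definition isothermal_charts :: "'a chart set \<Rightarrow> ('a chart \<Rightarrow> local_metric) \<Rightarrow> 'a chart set" where
  "isothermal_charts A g = {c \<in> A. \<exists>l. isothermal_with g c l}"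

text \<open>That the isothermal charts cover is a classical theorem (Gauss, Korn, Lichtenstein); it
  is recorded here as part of the notion of metric surface.\<close>

locale metric_surface = oriented_surface X A
  for X :: "'a topology" and A :: "'a chart set" +
  fixes g :: "'a chart \<Rightarrow> local_metric"
  assumes inner: "c \<in> A \<Longrightarrow> z \<in> chart_image c \<Longrightarrow> inner_form (g c z)"
    and smooth: "c \<in> A \<Longrightarrow> smooth_on (chart_image c) (\<lambda>z. g c z v w)"
    and invariant: "c \<in> A \<Longrightarrow> d \<in> A \<Longrightarrow> z \<in> overlap c d \<Longrightarrow>
      g c z v w = pullback (transition c d) (g d) z v w"
    and isothermal_cover: "(\<Union>c\<in>isothermal_charts A g. fst c) = topspace X"


section \<open>Beltrami differentials, quasi-conformal and conformal maps of surfaces\<close>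

text \<open>In the following definitions \<open>C\<close>, \<open>C'\<close> are the sets of charts of the Riemann surfaces in
  question, to be instantiated by the isothermal charts.\<close>

definition beltrami_differential :: "'a chart set \<Rightarrow> ('a chart \<Rightarrow> complex \<Rightarrow> complex) \<Rightarrow> bool" where
  "beltrami_differential C \<mu> \<longleftrightarrow>
     (\<forall>c\<in>C. \<mu> c \<in> borel_measurable (lebesgue_on (chart_image c)) \<and>
        (\<exists>K. AE z in lebesgue_on (chart_image c). cmod (\<mu> c z) \<le> K)) \<and>
     (\<forall>c\<in>C. \<forall>d\<in>C. AE z in lebesgue_on (overlap c d).
        \<mu> c z = \<mu> d (transition c d z) *
          cnj (deriv (transition c d) z) / deriv (transition c d) z)"

definition quasiconformal_map :: "'a topology \<Rightarrow> 'a chart set \<Rightarrow> 'b topology \<Rightarrow> 'b chart set \<Rightarrow>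
    ('a \<Rightarrow> 'b) \<Rightarrow> ('a chart \<Rightarrow> complex \<Rightarrow> complex) \<Rightarrow> bool" where
  "quasiconformal_map X C Y C' \<phi> \<mu> \<longleftrightarrow>
     homeomorphic_map X Y \<phi> \<and>
     (\<forall>c\<in>C. \<forall>d\<in>C'. quasiconformal_on (local_dom c d \<phi>) (local_rep c d \<phi>) (\<mu> c))"

text \<open>A Riemannian metric with measurable coefficients, identities being understood almost
  everywhere; the last condition is that its local expressions agree on overlaps.\<close>

definition ae_riemannian_metric :: "'a chart set \<Rightarrow> ('a chart \<Rightarrow> local_metric) \<Rightarrow> bool" where
  "ae_riemannian_metric C G \<longleftrightarrow>
     (\<forall>c\<in>C. (\<forall>v w. (\<lambda>z. G c z v w) \<in> borel_measurable (lebesgue_on (chart_image c))) \<and>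
        (AE z in lebesgue_on (chart_image c). inner_form (G c z))) \<and>
     (\<forall>c\<in>C. \<forall>d\<in>C. AE z in lebesgue_on (overlap c d).
        \<forall>v w. G c z v w = pullback (transition c d) (G d) z v w)"

text \<open>The metric \<open>exp (2\<lambda>) |dz + \<mu> cnj dz|\<^sup>2\<close>.\<close>

definition auxiliary_metric :: "('a chart \<Rightarrow> complex \<Rightarrow> real) \<Rightarrow> ('a chart \<Rightarrow> complex \<Rightarrow> complex) \<Rightarrow>
    'a chart \<Rightarrow> local_metric" where
  "auxiliary_metric l \<mu> c z v w =
     exp (2 * l c z) * ((v + \<mu> c z * cnj v) \<bullet> (w + \<mu> c z * cnj w))"

text \<open>The pull-back of \<open>h\<close> is \<open>exp (2u) G\<close> almost everywhere, with one function \<open>u\<close> on the whole source surface.\<close>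

definition conformal_map :: "'a chart set \<Rightarrow> ('a chart \<Rightarrow> local_metric) \<Rightarrow>
    'b chart set \<Rightarrow> ('b chart \<Rightarrow> local_metric) \<Rightarrow> ('a \<Rightarrow> 'b) \<Rightarrow> bool" where
  "conformal_map C G C' h \<phi> \<longleftrightarrow>
     (\<exists>u :: 'a \<Rightarrow> real. \<forall>c\<in>C. \<forall>d\<in>C'. AE z in lebesgue_on (local_dom c d \<phi>).
        local_rep c d \<phi> differentiable (at z) \<and>
        (\<forall>v w. pullback (local_rep c d \<phi>) (h d) z v w = exp (2 * u (chart_inv c z)) * G c z v w))"

end

theory Submission
  imports Defs
begin

text \<open>Everything rests on the decomposition \<open>D f v = f\<^sub>z v + f\<^sub>z\<^sub>b\<^sub>a\<^sub>r cnj v\<close> of a real-linear map of the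
  plane (\<open>frechet_derivative_d_z_d_zbar\<close>).

  Write \<open>f\<close> for \<open>\<phi>\<close> in isothermal coordinates. Almost everywhere the Beltrami equation turns the
  decomposition into \<open>D f v = f\<^sub>z (v + \<mu> cnj v)\<close>. Multiplication by \<open>f\<^sub>z\<close> scales inner products by
  \<open>|f\<^sub>z|\<^sup>2\<close>, so the pull-back of \<open>exp (2\<lambda>\<^sub>2) |dw|\<^sup>2\<close> is \<open>exp (2\<lambda>\<^sub>2 (f z)) |f\<^sub>z|\<^sup>2 |dz + \<mu> cnj dz|\<^sup>2\<close>, which is
  \<open>exp (2u)\<close> times the auxiliary metric for \<open>u = \<lambda>\<^sub>2 (f z) + ln |f\<^sub>z| - \<lambda>\<^sub>1 z\<close>.

  Two points remain, both about changes of chart. An orientation-preserving change \<open>T\<close> of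
  isothermal charts is holomorphic and satisfies \<open>exp (2\<lambda> z) = exp (2\<lambda>' (T z)) |T'|\<^sup>2\<close>
  (\<open>isothermal_transition\<close>); together with the transformation rule of a Beltrami differential this
  makes the auxiliary metric agree on overlaps. The same fact and the chain rule make \<open>u\<close>
  independent of the charts at every single point at which \<open>\<phi>\<close> is differentiable with \<open>f\<^sub>z \<noteq> 0\<close>
  (\<open>log_conformal_factor_chart_independent\<close>). As \<open>u\<close> does not involve \<open>\<mu>\<close>, no null sets enter
  here, and reading \<open>u\<close> at each point \<open>p\<close> in some pair of charts around \<open>p\<close> and \<open>\<phi> p\<close>
  gives one function on the whole surface.

  The auxiliary metric is positive definite where \<open>|\<mu>| < 1\<close>. Quasi-conformality gives this almost
  everywhere on the part of a chart that \<open>\<phi>\<close> maps into a single chart of the target; by the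
  Lindelof property countably many such parts cover the chart.\<close>


section \<open>Complex derivatives of real-differentiable maps\<close>

lemma frechet_derivative_d_z_d_zbar:
  assumes "f differentiable (at z)"
  shows "D f z v = d_z f z * v + d_zbar f z * cnj v"
proof -
  interpret linear "D f z"
    using assms by (rule linear_frechet_derivative)
  have "v = Re v *\<^sub>R 1 + Im v *\<^sub>R \<i>"
    by (simp add: complex_eq_iff)
  then have "D f z v = D f z (Re v *\<^sub>R 1 + Im v *\<^sub>R \<i>)"
    by (rule arg_cong)
  also have "\<dots> = Re v *\<^sub>R D f z 1 + Im v *\<^sub>R D f z \<i>"
    by (simp only: add scaleR)
  also have "\<dots> = d_z f z * v + d_zbar f z * cnj v"
    by (simp add: d_z_def d_zbar_def complex_eq_iff field_simps)
  finally show ?thesis .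
qed

lemma d_z_d_zbar_unique:
  assumes "(f has_derivative (\<lambda>v. p * v + q * cnj v)) (at z)"
  shows "d_z f z = p" "d_zbar f z = q"
proof -
  have "D f z = (\<lambda>v. p * v + q * cnj v)"
    using assms by (rule frechet_derivative_at[symmetric])
  then show "d_z f z = p" "d_zbar f z = q"
    by (simp_all add: d_z_def d_zbar_def complex_eq_iff)
qed

lemma jacobian_d_z_d_zbar: "jacobian f z = (cmod (d_z f z))\<^sup>2 - (cmod (d_zbar f z))\<^sup>2"
  unfolding jacobian_def d_z_def d_zbar_def cmod_power2
  by (simp add: field_simps power2_eq_square)

lemma d_z_nonzero_if_jacobian_pos:
  assumes "jacobian f z > 0" shows "d_z f z \<noteq> 0"
  using assms by (auto simp: jacobian_d_z_d_zbar)

lemma inner_mult_complex: "(a * v) \<bullet> (a * w) = (cmod a)\<^sup>2 * (v \<bullet> w)" for a v w :: complex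
  unfolding inner_complex_def cmod_power2 by (simp add: algebra_simps power2_eq_square)

text \<open>A derivative that scales all inner products by one factor has \<open>f\<^sub>z cnj f\<^sub>z\<^sub>b\<^sub>a\<^sub>r = 0\<close>: up to constants,
  the real part is the difference of the squared lengths of the images of \<open>1\<close> and \<open>\<i>\<close>, and the
  imaginary part is the inner product of these images. Positivity of the
  Jacobian leaves \<open>f\<^sub>z\<^sub>b\<^sub>a\<^sub>r = 0\<close>.\<close>

lemma has_field_derivative_if_conformal:
  assumes diff: "f differentiable (at z)" and jac: "jacobian f z > 0" and "s > 0"
    and conf: "\<And>v w. t * (v \<bullet> w) = s * (D f z v \<bullet> D f z w)"
  shows "(f has_field_derivative d_z f z) (at z)" "t = s * (cmod (d_z f z))\<^sup>2"
proof -
  let ?p = "d_z f z" and ?q = "d_zbar f z"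
  have D: "D f z v = ?p * v + ?q * cnj v" for v
    using diff by (rule frechet_derivative_d_z_d_zbar)
  have "D f z 1 \<bullet> D f z 1 = D f z \<i> \<bullet> D f z \<i>"
    using conf[of 1 1] conf[of \<i> \<i>] \<open>s > 0\<close> by simp
  then have "Re (?p * cnj ?q) = 0"
    by (simp add: D inner_complex_def algebra_simps)
  moreover have "D f z 1 \<bullet> D f z \<i> = 0"
    using conf[of 1 \<i>] \<open>s > 0\<close> by simp
  then have "Im (?p * cnj ?q) = 0"
    by (simp add: D inner_complex_def algebra_simps)
  ultimately have "?p * cnj ?q = 0"
    by (simp add: complex_eq_iff)
  then have q: "?q = 0"
    using d_z_nonzero_if_jacobian_pos[OF jac] by simp
  then have "D f z = (*) ?p"
    by (simp add: D fun_eq_iff)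
  then show "(f has_field_derivative ?p) (at z)"
    using diff unfolding has_field_derivative_def frechet_derivative_works by simp
  show "t = s * (cmod ?p)\<^sup>2"
    using conf[of 1 1] inner_mult_complex[of ?p 1 1] by (simp add: D q)
qed

lemma d_z_holomorphic_compose:
  assumes T: "(T has_field_derivative a) (at z)"
    and f: "f differentiable (at (T z))"
    and S: "(S has_field_derivative b) (at (f (T z)))"
  shows "d_z (S \<circ> f \<circ> T) z = b * d_z f (T z) * a"
proof -
  let ?p = "d_z f (T z)" and ?q = "d_zbar f (T z)"
  have "D f (T z) = (\<lambda>v. ?p * v + ?q * cnj v)"
    using frechet_derivative_d_z_d_zbar[OF f] by (simp add: fun_eq_iff)
  then have "(f has_derivative (\<lambda>v. ?p * v + ?q * cnj v)) (at (T z))"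
    using f unfolding frechet_derivative_works by simp
  then have "(f \<circ> T has_derivative (\<lambda>v. ?p * v + ?q * cnj v) \<circ> (*) a) (at z)"
    using T unfolding has_field_derivative_def by (rule diff_chain_at[rotated])
  then have "(S \<circ> (f \<circ> T) has_derivative (*) b \<circ> ((\<lambda>v. ?p * v + ?q * cnj v) \<circ> (*) a)) (at z)"
    by (rule diff_chain_at) (use S in \<open>simp add: has_field_derivative_def\<close>)
  moreover have "(*) b \<circ> ((\<lambda>v. ?p * v + ?q * cnj v) \<circ> (*) a) =
      (\<lambda>v. (b * ?p * a) * v + (b * ?q * cnj a) * cnj v)"
    by (auto simp: algebra_simps)
  ultimately show ?thesis
    by (simp add: comp_assoc d_z_d_zbar_unique(1))
qed

lemma d_z_cong_open:
  assumes "open U" "z \<in> U" "\<And>x. x \<in> U \<Longrightarrow> f x = h x"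
  shows "d_z f z = d_z h z"
proof -
  have "(f has_derivative F) (at z) \<longleftrightarrow> (h has_derivative F) (at z)" for F
    using assms by (auto intro: has_derivative_transform_within_open[where s = U])
  then show ?thesis
    by (simp add: d_z_def frechet_derivative_def)
qed


section \<open>Charts and transition maps\<close>

lemma chart_inj_on: "chart_on X c \<Longrightarrow> inj_on (snd c) (fst c)"
  unfolding chart_on_def homeomorphic_map_def
  by (metis homeomorphic_imp_injective_map homeomorphic_map_def openin_subset topspace_subtopology_subset)

lemma chart_inv_apply:
  assumes "chart_on X c" "p \<in> fst c" shows "chart_inv c (snd c p) = p"
  using chart_inj_on[OF assms(1)] assms(2) by (simp add: chart_inv_def)

lemma chart_image_open_subset:
  assumes c: "chart_on X c" and U: "openin X U" "U \<subseteq> fst c"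
  shows "open (snd c ` U)"
proof -
  have "openin (subtopology X (fst c)) U"
    using U by (auto simp: openin_subtopology_alt)
  then have "openin (top_of_set (chart_image c)) (snd c ` U)"
    using c homeomorphic_imp_open_map[of "subtopology X (fst c)" "top_of_set (chart_image c)" "snd c"]
    by (auto simp: chart_on_def open_map_def)
  then show ?thesis
    using c by (auto simp: chart_on_def openin_open_eq)
qed

lemma open_overlap:
  assumes "chart_on X c" "chart_on X d" shows "open (overlap c d)"
  using assms unfolding local_dom_def
  by (intro chart_image_open_subset[of X]) (auto simp: chart_on_def)

lemma differentiable_if_smooth_on:
  assumes "smooth_on S f" "z \<in> S" shows "f differentiable (at z)"
proof -
  have "Ck_on (Suc 0) S f" using assms(1) by (simp add: smooth_on_def)
  then show ?thesis using assms(2) by (auto simp: differentiable_def)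
qed

text \<open>In isothermal charts both metrics are multiples of the Euclidean one, so invariance of the
  metric says that the derivative of the transition map is conformal.\<close>

lemma isothermal_transition:
  assumes S: "metric_surface X A g" and cd: "c \<in> A" "d \<in> A"
    and iso: "isothermal_with g c k" "isothermal_with g d l" and z: "z \<in> overlap c d"
  shows "(transition c d has_field_derivative d_z (transition c d) z) (at z)"
    and "d_z (transition c d) z \<noteq> 0"
    and "exp (2 * k z) = exp (2 * l (transition c d z)) * (cmod (d_z (transition c d) z))\<^sup>2"
proof -
  interpret metric_surface X A g by (fact S)
  let ?T = "transition c d"
  have oc: "smooth_on (overlap c d) ?T" "jacobian ?T z > 0"
    using compatible[OF cd] z by (auto simp: oriented_compatible_def)
  have zc: "z \<in> chart_image c" and Tz: "?T z \<in> chart_image d"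
    using z chart_inv_apply[OF charts[OF cd(1)]] by (auto simp: local_dom_def local_rep_def)
  have conf: "exp (2 * k z) * (v \<bullet> w) = exp (2 * l (?T z)) * (D ?T z v \<bullet> D ?T z w)" for v w
    using invariant[OF cd z, of v w] iso[unfolded isothermal_with_def] zc Tz
    unfolding pullback_def by metis
  show "(?T has_field_derivative d_z ?T z) (at z)"
    and "exp (2 * k z) = exp (2 * l (?T z)) * (cmod (d_z ?T z))\<^sup>2"
    using has_field_derivative_if_conformal[OF differentiable_if_smooth_on[OF oc(1) z] oc(2) _ conf]
    by simp_all
  show "d_z ?T z \<noteq> 0"
    using oc(2) by (rule d_z_nonzero_if_jacobian_pos)
qed


section \<open>The auxiliary metric\<close>

lemma inner_form_auxiliary_metric:
  assumes "cmod (\<mu> c z) < 1"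
  shows "inner_form (auxiliary_metric l \<mu> c z)"
proof -
  have nz: "v + \<mu> c z * cnj v \<noteq> 0" if "v \<noteq> 0" for v
  proof
    assume "v + \<mu> c z * cnj v = 0"
    then have "cmod v = cmod (\<mu> c z) * cmod v"
      by (metis add_eq_0_iff complex_mod_cnj norm_minus_cancel norm_mult)
    then show False using assms that by simp
  qed
  have "bilinear (auxiliary_metric l \<mu> c z)"
    unfolding bilinear_def auxiliary_metric_def
    by (auto intro!: linearI simp: algebra_simps inner_add_left inner_add_right scaleR_conv_of_real
        inner_complex_def)
  then show ?thesis
    using nz by (auto simp: inner_form_def auxiliary_metric_def inner_commute)
qed

lemma auxiliary_metric_measurable:
  assumes S: "metric_surface X A g" and c: "c \<in> A" and iso: "isothermal_with g c (l c)"
    and \<mu>: "\<mu> c \<in> borel_measurable (lebesgue_on (chart_image c))"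
  shows "(\<lambda>z. auxiliary_metric l \<mu> c z v w) \<in> borel_measurable (lebesgue_on (chart_image c))"
proof -
  interpret metric_surface X A g by (fact S)
  have "open (chart_image c)"
    using charts[OF c] by (simp add: chart_on_def)
  moreover have "Ck_on 0 (chart_image c) (\<lambda>z. g c z 1 1)"
    using smooth[OF c] unfolding smooth_on_def by blast
  ultimately have "(\<lambda>z. g c z 1 1) \<in> borel_measurable (lebesgue_on (chart_image c))"
    by (intro continuous_imp_measurable_on_sets_lebesgue) auto
  moreover have "exp (2 * l c z) = g c z 1 1" if "z \<in> chart_image c" for z
    using iso that unfolding isothermal_with_def by fastforce
  ultimately have "(\<lambda>z. exp (2 * l c z)) \<in> borel_measurable (lebesgue_on (chart_image c))"
    by (subst measurable_cong[where g = "\<lambda>z. g c z 1 1"]) simp_all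
  then show ?thesis
    unfolding auxiliary_metric_def using \<mu> by measurable
qed

lemma auxiliary_metric_invariant:
  assumes S: "metric_surface X A g" and cd: "c \<in> A" "d \<in> A"
    and iso: "isothermal_with g c (l c)" "isothermal_with g d (l d)" and z: "z \<in> overlap c d"
    and \<mu>: "\<mu> c z = \<mu> d (transition c d z) *
      cnj (deriv (transition c d) z) / deriv (transition c d) z"
  shows "auxiliary_metric l \<mu> c z v w = pullback (transition c d) (auxiliary_metric l \<mu> d) z v w"
proof -
  let ?T = "transition c d"
  define a where "a = d_z ?T z"
  note tr = isothermal_transition[OF S cd iso z, folded a_def]
  \<comment> \<open>\<open>dw = a dz\<close> and the rule for \<open>\<mu>\<close> give \<open>dw + \<mu>' cnj dw = a (dz + \<mu> cnj dz)\<close>\<close>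
  have DT: "D ?T z = (*) a"
    using tr(1) by (auto simp: has_field_derivative_def dest: frechet_derivative_at)
  have "\<mu> c z = \<mu> d (?T z) * cnj a / a"
    using \<mu> DERIV_imp_deriv[OF tr(1)] by simp
  then have "a * v + \<mu> d (?T z) * cnj (a * v) = a * (v + \<mu> c z * cnj v)" for v
    using tr(2) by (simp add: field_simps)
  then show ?thesis
    unfolding pullback_def auxiliary_metric_def DT by (simp only: inner_mult_complex tr(3) mult.assoc)
qed

text \<open>The bound on \<open>\<mu>\<close> is given separately for each chart of the target, with a constant and a
  null set depending on that chart; countably many charts of the target suffice.\<close>

lemma quasiconformal_AE_norm_less_1:
  assumes S1: "metric_surface X1 A1 g1" and S2: "metric_surface X2 A2 g2"
    and qc: "quasiconformal_map X1 C X2 (isothermal_charts A2 g2) \<phi> \<mu>"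
    and c: "c \<in> C" "c \<in> A1"
  shows "AE z in lebesgue_on (chart_image c). cmod (\<mu> c z) < 1"
proof -
  interpret S1: metric_surface X1 A1 g1 by (fact S1)
  interpret S2: metric_surface X2 A2 g2 by (fact S2)
  let ?C' = "isothermal_charts A2 g2"
  let ?F = "(\<lambda>d. local_dom c d \<phi>) ` ?C'"
  have "fst c \<subseteq> topspace X1"
    using S1.charts[OF c(2)] openin_subset by (auto simp: chart_on_def)
  moreover have "\<phi> ` topspace X1 = topspace X2"
    using qc by (simp add: quasiconformal_map_def homeomorphic_imp_surjective_map)
  ultimately have covered: "\<phi> ` fst c \<subseteq> (\<Union>d\<in>?C'. fst d)"
    using S2.isothermal_cover by auto
  have cover: "chart_image c = \<Union>?F"
    using covered by (fastforce simp: local_dom_def)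
  have "open V" if "V \<in> ?F" for V
    using qc c(1) that by (auto simp: quasiconformal_map_def quasiconformal_on_def)
  then obtain F where F: "F \<subseteq> ?F" "countable F" "\<Union>F = \<Union>?F"
    using Lindelof[of ?F] by metis
  have "AE z in lebesgue. z \<in> V \<longrightarrow> cmod (\<mu> c z) < 1" if "V \<in> F" for V
  proof -
    obtain d where d: "d \<in> ?C'" "V = local_dom c d \<phi>"
      using F(1) \<open>V \<in> F\<close> by auto
    then have q: "quasiconformal_on V (local_rep c d \<phi>) (\<mu> c)"
      using qc c(1) by (auto simp: quasiconformal_map_def)
    then obtain k where k: "k < 1" "AE z in lebesgue_on V. cmod (\<mu> c z) \<le> k"
      by (auto simp: quasiconformal_on_def)
    have "open V" using q by (simp add: quasiconformal_on_def)
    then have "V \<in> sets lebesgue" by simp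
    then have "AE z in lebesgue. z \<in> V \<longrightarrow> cmod (\<mu> c z) \<le> k"
      using k(2) by (simp add: AE_restrict_space_iff)
    then show ?thesis
      using k(1) by (auto elim: eventually_mono)
  qed
  then have "AE z in lebesgue. \<forall>V\<in>F. z \<in> V \<longrightarrow> cmod (\<mu> c z) < 1"
    unfolding AE_ball_countable[OF F(2)] by blast
  then have "AE z in lebesgue. z \<in> chart_image c \<longrightarrow> cmod (\<mu> c z) < 1"
    unfolding cover F(3)[symmetric] by (auto elim: eventually_mono)
  moreover have "chart_image c \<in> sets lebesgue"
    using S1.charts[OF c(2)] by (simp add: chart_on_def)
  ultimately show ?thesis
    by (simp add: AE_restrict_space_iff)
qed


section \<open>The conformal factor\<close>

text \<open>The function \<open>u\<close> with \<open>exp (2u) = exp (2\<lambda>\<^sub>2 (f z)) |f\<^sub>z|\<^sup>2 / exp (2\<lambda>\<^sub>1 z)\<close>, as a function on the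
  surface read in the charts \<open>c\<close> and \<open>d\<close>.\<close>

definition log_conformal_factor ::
    "('a chart \<Rightarrow> complex \<Rightarrow> real) \<Rightarrow> ('b chart \<Rightarrow> complex \<Rightarrow> real) \<Rightarrow> ('a \<Rightarrow> 'b) \<Rightarrow>
      'a chart \<Rightarrow> 'b chart \<Rightarrow> 'a \<Rightarrow> real" where
  "log_conformal_factor l1 l2 \<phi> c d p =
     l2 d (snd d (\<phi> p)) + ln (cmod (d_z (local_rep c d \<phi>) (snd c p))) - l1 c (snd c p)"

text \<open>Under a change of charts, \<open>\<lambda>\<^sub>1\<close> and \<open>\<lambda>\<^sub>2\<close> change by the logarithms of the absolute values of the
  derivatives of the transition maps, and the chain rule puts exactly these into \<open>ln |f\<^sub>z|\<close>.\<close>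

lemma log_conformal_factor_chart_independent:
  assumes S1: "metric_surface X1 A1 g1" and S2: "metric_surface X2 A2 g2"
    and c: "c \<in> A1" "isothermal_with g1 c (l1 c)" and c': "c' \<in> A1" "isothermal_with g1 c' (l1 c')"
    and d: "d \<in> A2" "isothermal_with g2 d (l2 d)" and d': "d' \<in> A2" "isothermal_with g2 d' (l2 d')"
    and op: "open (local_dom c' d \<phi>)" "open (local_dom c' d' \<phi>)"
    and p: "p \<in> fst c" "p \<in> fst c'" "\<phi> p \<in> fst d" "\<phi> p \<in> fst d'"
    and diff: "local_rep c d \<phi> differentiable (at (snd c p))"
    and nz: "d_z (local_rep c d \<phi>) (snd c p) \<noteq> 0"
  shows "log_conformal_factor l1 l2 \<phi> c' d' p = log_conformal_factor l1 l2 \<phi> c d p"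
proof -
  interpret S1: metric_surface X1 A1 g1 by (fact S1)
  interpret S2: metric_surface X2 A2 g2 by (fact S2)
  note inv = chart_inv_apply[OF S1.charts[OF c(1)]] chart_inv_apply[OF S1.charts[OF c'(1)]]
    chart_inv_apply[OF S2.charts[OF d(1)]] chart_inv_apply[OF S2.charts[OF d'(1)]]
  let ?f = "local_rep c d \<phi>" and ?f' = "local_rep c' d' \<phi>"
  let ?T = "transition c' c" and ?S = "transition d d'"
  let ?z = "snd c p" and ?z' = "snd c' p" and ?w = "snd d (\<phi> p)" and ?w' = "snd d' (\<phi> p)"
  define a where "a = d_z ?T ?z'"
  define b where "b = d_z ?S ?w"
  have T: "?T ?z' = ?z" and S: "?S ?w = ?w'" and f: "?f ?z = ?w"
    using p inv by (simp_all add: local_rep_def)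
  have z': "?z' \<in> overlap c' c" and w: "?w \<in> overlap d d'"
    using p by (auto simp: local_dom_def)
  note tr1 = isothermal_transition[OF S1 c'(1) c(1) c'(2) c(2) z', folded a_def, unfolded T]
  note tr2 = isothermal_transition[OF S2 d(1) d'(1) d(2) d'(2) w, folded b_def, unfolded S]
  have log: "k = l + ln (cmod t)" if "exp (2 * k) = exp (2 * l) * (cmod t)\<^sup>2" "t \<noteq> 0" for k l t
  proof -
    have "exp (2 * k) = exp (2 * (l + ln (cmod t)))"
      using that by (simp add: distrib_left exp_add exp_double)
    then show ?thesis by simp
  qed
  \<comment> \<open>the factorization of \<open>?f'\<close> passes through all four charts, hence the intersection with
    \<open>local_dom c' d \<phi>\<close>\<close>
  let ?U = "overlap c' c \<inter> (local_dom c' d \<phi> \<inter> local_dom c' d' \<phi>)"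
  have "?f' x = (?S \<circ> ?f \<circ> ?T) x" if x: "x \<in> ?U" for x
  proof -
    have inj: "inj_on (snd c') (fst c')"
      using S1.charts[OF c'(1)] by (rule chart_inj_on)
    obtain q where "x = snd c' q" "q \<in> fst c'" "q \<in> fst c" "\<phi> q \<in> fst d" "\<phi> q \<in> fst d'"
      using x inj by (auto simp: local_dom_def dest: inj_onD)
    then show ?thesis
      using inv by (simp add: local_rep_def)
  qed
  moreover have "open ?U"
    using op open_overlap[OF S1.charts[OF c'(1)] S1.charts[OF c(1)]] by auto
  moreover have "?z' \<in> ?U"
    using p by (auto simp: local_dom_def)
  ultimately have "d_z ?f' ?z' = d_z (?S \<circ> ?f \<circ> ?T) ?z'"
    by (intro d_z_cong_open[of ?U]) auto
  also have "\<dots> = b * d_z ?f ?z * a"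
    using d_z_holomorphic_compose[of ?T a ?z' ?f ?S b] tr1(1) tr2(1) diff T f by simp
  finally have "ln (cmod (d_z ?f' ?z')) = ln (cmod b) + ln (cmod (d_z ?f ?z)) + ln (cmod a)"
    using tr1(2) tr2(2) nz by (simp add: norm_mult ln_mult)
  moreover note log[OF tr1(3,2)] log[OF tr2(3,2)]
  ultimately show ?thesis
    by (simp add: log_conformal_factor_def)
qed

text \<open>The Beltrami equation at one point suffices: it gives \<open>D f v = f\<^sub>z (v + \<mu> cnj v)\<close> there.\<close>

lemma pullback_beltrami:
  assumes iso: "isothermal_with g d (l2 d)" and d: "\<phi> p \<in> fst d"
    and c: "chart_on X c" "p \<in> fst c"
    and diff: "local_rep c d \<phi> differentiable (at (snd c p))"
    and nz: "d_z (local_rep c d \<phi>) (snd c p) \<noteq> 0"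
    and beltrami: "d_zbar (local_rep c d \<phi>) (snd c p) = \<mu> c (snd c p) * d_z (local_rep c d \<phi>) (snd c p)"
  shows "pullback (local_rep c d \<phi>) (g d) (snd c p) v w =
    exp (2 * log_conformal_factor l1 l2 \<phi> c d p) * auxiliary_metric l1 \<mu> c (snd c p) v w"
proof -
  let ?f = "local_rep c d \<phi>" and ?z = "snd c p"
  define a where "a = d_z ?f ?z"
  have "D ?f ?z v = a * (v + \<mu> c ?z * cnj v)" for v
    using frechet_derivative_d_z_d_zbar[OF diff, of v] beltrami
    by (simp add: a_def algebra_simps)
  moreover have "?f ?z = snd d (\<phi> p)"
    using chart_inv_apply[OF c] by (simp add: local_rep_def)
  ultimately have "pullback ?f (g d) ?z v w = exp (2 * l2 d (snd d (\<phi> p))) *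
      ((cmod a)\<^sup>2 * ((v + \<mu> c ?z * cnj v) \<bullet> (w + \<mu> c ?z * cnj w)))"
    using iso d by (simp add: pullback_def isothermal_with_def inner_mult_complex)
  moreover have "exp (2 * log_conformal_factor l1 l2 \<phi> c d p) =
      exp (2 * l2 d (snd d (\<phi> p))) * (cmod a)\<^sup>2 / exp (2 * l1 c ?z)"
    using nz by (simp add: log_conformal_factor_def a_def right_diff_distrib distrib_left
        exp_add exp_diff exp_double)
  ultimately show ?thesis
    by (simp add: auxiliary_metric_def)
qed


section \<open>Quasi-conformal maps are conformal for the auxiliary metric\<close>

theorem theorem5p1:
  fixes X1 :: "'a topology" and A1 :: "'a chart set" and g1 :: "'a chart \<Rightarrow> local_metric"
    and X2 :: "'b topology" and A2 :: "'b chart set" and g2 :: "'b chart \<Rightarrow> local_metric"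
    and lam1 :: "'a chart \<Rightarrow> complex \<Rightarrow> real" and lam2 :: "'b chart \<Rightarrow> complex \<Rightarrow> real"
    and \<mu> :: "'a chart \<Rightarrow> complex \<Rightarrow> complex" and \<phi> :: "'a \<Rightarrow> 'b"
  assumes "metric_surface X1 A1 g1" and "metric_surface X2 A2 g2"
    and "\<And>c. c \<in> isothermal_charts A1 g1 \<Longrightarrow> isothermal_with g1 c (lam1 c)"
    and "\<And>d. d \<in> isothermal_charts A2 g2 \<Longrightarrow> isothermal_with g2 d (lam2 d)"
    and "beltrami_differential (isothermal_charts A1 g1) \<mu>"
    and "quasiconformal_map X1 (isothermal_charts A1 g1) X2 (isothermal_charts A2 g2) \<phi> \<mu>"
  shows "ae_riemannian_metric (isothermal_charts A1 g1) (auxiliary_metric lam1 \<mu>) \<and>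
    conformal_map (isothermal_charts A1 g1) (auxiliary_metric lam1 \<mu>)
      (isothermal_charts A2 g2) g2 \<phi>"
proof
  note S1 = assms(1) and S2 = assms(2) and iso1 = assms(3) and iso2 = assms(4)
    and belt = assms(5) and qc = assms(6)
  interpret S1: metric_surface X1 A1 g1 by (fact S1)
  let ?C = "isothermal_charts A1 g1" and ?C' = "isothermal_charts A2 g2"
  let ?G = "auxiliary_metric lam1 \<mu>"
  have A: "c \<in> ?C \<Longrightarrow> c \<in> A1" "d \<in> ?C' \<Longrightarrow> d \<in> A2" for c d
    by (simp_all add: isothermal_charts_def)
  show "ae_riemannian_metric ?C ?G"
    unfolding ae_riemannian_metric_def
  proof (intro conjI ballI allI)
    fix c v w assume c: "c \<in> ?C"
    then show "(\<lambda>z. ?G c z v w) \<in> borel_measurable (lebesgue_on (chart_image c))"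
      using belt by (intro auxiliary_metric_measurable[OF S1 A(1)] iso1)
        (auto simp: beltrami_differential_def)
  next
    fix c assume c: "c \<in> ?C"
    show "AE z in lebesgue_on (chart_image c). inner_form (?G c z)"
      using quasiconformal_AE_norm_less_1[OF S1 S2 qc c A(1)[OF c]]
      by (rule eventually_mono) (rule inner_form_auxiliary_metric)
  next
    fix c d assume c: "c \<in> ?C" and d: "d \<in> ?C"
    have "AE z in lebesgue_on (overlap c d). \<mu> c z = \<mu> d (transition c d z) *
        cnj (deriv (transition c d) z) / deriv (transition c d) z"
      using belt c d by (simp add: beltrami_differential_def)
    then show "AE z in lebesgue_on (overlap c d).
        \<forall>v w. ?G c z v w = pullback (transition c d) (?G d) z v w"
      using AE_space
    proof eventually_elim
      case (elim z)
      then show ?case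
        using auxiliary_metric_invariant[of X1 A1 g1 c d lam1 z \<mu>,
            OF S1 A(1)[OF c] A(1)[OF d] iso1[OF c] iso1[OF d]]
        by simp
    qed
  qed
  show "conformal_map ?C ?G ?C' g2 \<phi>"
  proof -
    define c0 where "c0 p = (SOME c. c \<in> ?C \<and> p \<in> fst c)" for p
    define d0 where "d0 p = (SOME d. d \<in> ?C' \<and> \<phi> p \<in> fst d)" for p
    define u where "u p = log_conformal_factor lam1 lam2 \<phi> (c0 p) (d0 p) p" for p
    have "AE z in lebesgue_on (local_dom c d \<phi>). local_rep c d \<phi> differentiable (at z) \<and>
        (\<forall>v w. pullback (local_rep c d \<phi>) (g2 d) z v w =
          exp (2 * u (chart_inv c z)) * ?G c z v w)"
      if c: "c \<in> ?C" and d: "d \<in> ?C'" for c d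
    proof -
      let ?f = "local_rep c d \<phi>"
      have op: "open (local_dom c' d' \<phi>)" if "c' \<in> ?C" "d' \<in> ?C'" for c' d'
        using qc that by (auto simp: quasiconformal_map_def quasiconformal_on_def)
      have "quasiconformal_on (local_dom c d \<phi>) ?f (\<mu> c)"
        using qc c d by (simp add: quasiconformal_map_def)
      then have "AE z in lebesgue_on (local_dom c d \<phi>). ?f differentiable (at z) \<and> jacobian ?f z > 0"
        and "AE z in lebesgue_on (local_dom c d \<phi>). d_zbar ?f z = \<mu> c z * d_z ?f z"
        by (simp_all add: quasiconformal_on_def orientation_preserving_on_def)
      then show ?thesis
        using AE_space
      proof eventually_elim
        case (elim z)
        then obtain p where p: "p \<in> fst c" "\<phi> p \<in> fst d" and z: "z = snd c p"
          by (auto simp: local_dom_def)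
        have inv: "chart_inv c z = p"
          using chart_inv_apply[OF S1.charts[OF A(1)[OF c]] p(1)] z by simp
        have diff: "?f differentiable (at (snd c p))" and nz: "d_z ?f (snd c p) \<noteq> 0"
          and beltrami: "d_zbar ?f (snd c p) = \<mu> c (snd c p) * d_z ?f (snd c p)"
          using elim d_z_nonzero_if_jacobian_pos[of ?f z] by (auto simp: z)
        have c0: "c0 p \<in> ?C \<and> p \<in> fst (c0 p)"
          unfolding c0_def by (rule someI[of _ c]) (use c p in simp)
        have d0: "d0 p \<in> ?C' \<and> \<phi> p \<in> fst (d0 p)"
          unfolding d0_def by (rule someI[of _ d]) (use d p in simp)
        have "u p = log_conformal_factor lam1 lam2 \<phi> c d p"
          unfolding u_def using c d c0 d0 p diff nz
          by (intro log_conformal_factor_chart_independent[OF S1 S2]) (auto intro: A iso1 iso2 op)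
        then have "pullback ?f (g2 d) z v w = exp (2 * u (chart_inv c z)) * ?G c z v w" for v w
          using pullback_beltrami[of g2 d lam2 \<phi> p X1 c \<mu> v w lam1, OF iso2[OF d] p(2)
              S1.charts[OF A(1)[OF c]] p(1) diff nz beltrami]
          by (simp add: inv z[symmetric])
        then show ?case
          using elim by simp
      qed
    qed
    then show ?thesis
      unfolding conformal_map_def by blast
  qed
qed

end
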